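(* Let $b \ge 2$ be an integer. For every real number $\xi > 0$ there exist an integer $s \ge 0$, integers $A_1, A_2, \dots, A_{s+1}$ and an infinite sequence of integers $a_1, a_2, a_3, \dots$ such that $$\xi = \lim_{n \to \infty} A_1 A_2 \cdots A_{s+1}.\,a_1 a_2 a_3 \cdots a_n ,$$ where the right-hand side is in base-$b$ positional notation, and such that: $0 \le A_i < b$ for all $1 \le i \le s+1$ and $0 \le a_n < b$ for all $n \ge 1$; not all of the $A_i$ and $a_n$ are $0$; infinitely many of the $a_n$ are less than $b-1$; and if $\xi \ge 1$, then $A_1 > 0$.
   Context: For an integer base $b \ge 2$ and integers $A_1, \dots, A_{s+1}, a_1, \dots, a_n$ in $\{0, 1, \dots, b-1\}$, the base-$b$ notation $A_1 A_2 \cdots A_{s+1}.\,a_1 a_2 \cdots a_n$ (juxtaposition of digits, not multiplication) denotes the real number $$\sum_{i=1}^{s+1} A_i\, b^{\,s+1-i} + \sum_{k=1}^{n} \frac{a_k}{b^k}.$$ *)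

theory Defs
  imports Complex_Main
begin

text \<open>
  The base-\<open>b\<close> notation \<open>A\<^sub>1 A\<^sub>2 \<dots> A\<^sub>m . a\<^sub>1 a\<^sub>2 \<dots> a\<^sub>n\<close>, with \<open>m\<close> digits before and \<open>n\<close> digits after
  the radix point. Both digit sequences are indexed from 1; the values of \<open>A\<close> outside \<open>{1..m}\<close>
  and of \<open>a\<close> outside \<open>{1..n}\<close> are irrelevant.
\<close>

definition positional :: "int \<Rightarrow> nat \<Rightarrow> (nat \<Rightarrow> int) \<Rightarrow> nat \<Rightarrow> (nat \<Rightarrow> int) \<Rightarrow> real" where
  "positional b m A n a =
     (\<Sum>i=1..m. of_int (A i) * of_int b ^ (m - i)) + (\<Sum>k=1..n. of_int (a k) / of_int b ^ k)"

end

theory Submission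
  imports Defs
begin

text \<open>
  The integer part of \<open>\<xi>\<close> is expanded by repeated division by \<open>b\<close>. The fractional digits are
  \<open>a\<^sub>k = \<lfloor>b^k \<xi>\<rfloor> - b \<lfloor>b^(k-1) \<xi>\<rfloor>\<close>, so that the truncation after \<open>n\<close> digits telescopes to
  \<open>\<lfloor>b^n \<xi>\<rfloor> / b^n\<close>. The gaps \<open>d\<^sub>n = 1 - frac (b^n \<xi>)\<close> lie in \<open>(0, 1]\<close>, and \<open>a\<^sub>n\<^sub>+\<^sub>1 = b - 1\<close> forces
  \<open>d\<^sub>n\<^sub>+\<^sub>1 = b d\<^sub>n\<close>; hence the digit \<open>b - 1\<close> cannot recur forever.
\<close>

text \<open>Strong induction on \<open>N\<close>: the digits of \<open>N div b\<close> are kept and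
  \<open>N mod b\<close> is appended as the last one. The leading digit never changes, so its
  positivity is inherited from the base case \<open>N < b\<close>, where \<open>N\<close> is its own
  single digit (possibly 0).\<close>

lemma integer_digit_expansion:
  fixes b N :: int
  assumes "b \<ge> 2" "N \<ge> 0"
  shows "\<exists>(s::nat) A. (\<Sum>i=1..s+1. A i * b ^ (s + 1 - i)) = N \<and>
           (\<forall>i\<in>{1..s+1}. 0 \<le> A i \<and> A i < b) \<and> (N \<ge> 1 \<longrightarrow> A 1 > 0)"
  using assms(2)
proof (induction "nat N" arbitrary: N rule: less_induct)
  case less
  show ?case
  proof (cases "N < b")
    case True
    then show ?thesis
      using less.prems by (intro exI[of _ 0] exI[of _ "\<lambda>_. N"]) auto
  next
    case False
    \<comment> \<open>A nonzero quotient is what lets the induction hypothesis supply a positive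
      leading digit.\<close>
    have quot_pos: "1 \<le> N div b"
      using False assms(1) by (simp add: pos_imp_zdiv_pos_iff int_one_le_iff_zero_less)
    have "nat (N div b) < nat N"
      using False assms(1) by (simp add: int_div_less_self)
    from less.hyps[OF this] quot_pos obtain s A where
      sum_A: "(\<Sum>i=1..s+1. A i * b ^ (s + 1 - i)) = N div b" and
      digits: "\<forall>i\<in>{1..s+1}. 0 \<le> A i \<and> A i < b" and lead: "A 1 > 0"
      by fastforce
    define A' where "A' = A(s + 2 := N mod b)"
    have "(\<Sum>i=1..Suc s + 1. A' i * b ^ (Suc s + 1 - i)) =
        (\<Sum>i=1..s+1. A' i * b ^ (Suc s + 1 - i)) + N mod b"
      by (simp add: A'_def)
    also have "(\<Sum>i=1..s+1. A' i * b ^ (Suc s + 1 - i)) = (\<Sum>i=1..s+1. b * (A i * b ^ (s + 1 - i)))"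
      by (rule sum.cong) (auto simp: A'_def Suc_diff_le)
    also have "\<dots> = b * (N div b)"
      using sum_A by (metis sum_distrib_left)
    finally have "(\<Sum>i=1..Suc s + 1. A' i * b ^ (Suc s + 1 - i)) = N"
      by simp
    moreover have "\<forall>i\<in>{1..Suc s + 1}. 0 \<le> A' i \<and> A' i < b"
      using digits assms(1) by (auto simp: A'_def)
    moreover have "A' 1 > 0"
      using lead by (simp add: A'_def)
    ultimately show ?thesis by blast
  qed
qed

text \<open>Meaningful for \<open>k \<ge> 1\<close> only: at \<open>k = 0\<close> the truncated
  \<open>k - 1\<close> yields a junk value.\<close>

definition frac_digit :: "int \<Rightarrow> real \<Rightarrow> nat \<Rightarrow> int" where
  "frac_digit b x k = \<lfloor>of_int b ^ k * x\<rfloor> - b * \<lfloor>of_int b ^ (k - 1) * x\<rfloor>"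

text \<open>Writing each floor as \<open>y - frac y\<close>, the terms in \<open>x\<close> itself
  cancel. Both the digit bounds and the growth of the gaps come from this recurrence.\<close>

lemma frac_digit_Suc_eq_frac:
  "of_int (frac_digit b x (Suc n)) = of_int b * frac (of_int b ^ n * x) - frac (of_int b ^ Suc n * x)"
  by (simp add: frac_digit_def frac_def algebra_simps)

lemma frac_digit_bounds:
  assumes "b \<ge> 2" "n \<ge> 1"
  shows "0 \<le> frac_digit b x n" "frac_digit b x n < b"
proof -
  obtain m where n: "n = Suc m"
    using assms(2) by (cases n) auto
  define r where "r = frac (of_int b ^ m * x)"
  define r' where "r' = frac (of_int b ^ Suc m * x)"
  have r: "0 \<le> r" "r < 1" "0 \<le> r'" "r' < 1"
    by (simp_all add: r_def r'_def frac_lt_1)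
  have b: "(0::real) < of_int b"
    using assms(1) by simp
  have d: "of_int (frac_digit b x n) = of_int b * r - r'"
    unfolding n r_def r'_def by (rule frac_digit_Suc_eq_frac)
  have "0 \<le> of_int b * r" "of_int b * r < of_int b"
    using r b by auto
  \<comment> \<open>The strict bound -1 suffices below because the digit is an integer.\<close>
  with d r have "(-1::real) < of_int (frac_digit b x n)" "real_of_int (frac_digit b x n) < of_int b"
    by linarith+
  then show "0 \<le> frac_digit b x n" "frac_digit b x n < b"
    by linarith+
qed

text \<open>Each summand is a difference of consecutive truncations; the subtracted
  \<open>\<lfloor>x\<rfloor>\<close> is the boundary term left by telescoping.\<close>

lemma sum_frac_digit:
  assumes "b \<noteq> 0"
  shows "(\<Sum>k=1..n. of_int (frac_digit b x k) / of_int b ^ k) =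
           of_int \<lfloor>of_int b ^ n * x\<rfloor> / of_int b ^ n - (of_int \<lfloor>x\<rfloor> :: real)"
proof (induction n)
  case (Suc n)
  have "of_int (frac_digit b x (Suc n)) / of_int b ^ Suc n =
      of_int \<lfloor>of_int b ^ Suc n * x\<rfloor> / of_int b ^ Suc n - (of_int \<lfloor>of_int b ^ n * x\<rfloor> / of_int b ^ n :: real)"
    using assms by (simp add: frac_digit_def diff_divide_distrib)
  with Suc show ?case by simp
qed simp

text \<open>The floor loses less than 1, so after scaling the error is at most
  \<open>(1 / B) ^ n\<close>.\<close>

lemma floor_power_mult_div_tendsto:
  fixes B x :: real
  assumes "B > 1"
  shows "(\<lambda>n. of_int \<lfloor>B ^ n * x\<rfloor> / B ^ n) \<longlonglongrightarrow> x"
proof (rule tendsto_sandwich)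
  show "\<forall>\<^sub>F n in sequentially. x - (1 / B) ^ n \<le> of_int \<lfloor>B ^ n * x\<rfloor> / B ^ n"
  proof (intro always_eventually allI)
    fix n
    have "B ^ n > 0" using assms by simp
    moreover have "B ^ n * x - 1 \<le> of_int \<lfloor>B ^ n * x\<rfloor>" by linarith
    ultimately have "(B ^ n * x - 1) / B ^ n \<le> of_int \<lfloor>B ^ n * x\<rfloor> / B ^ n"
      by (intro divide_right_mono) auto
    then show "x - (1 / B) ^ n \<le> of_int \<lfloor>B ^ n * x\<rfloor> / B ^ n"
      using assms by (simp add: diff_divide_distrib power_one_over)
  qed
  show "\<forall>\<^sub>F n in sequentially. of_int \<lfloor>B ^ n * x\<rfloor> / B ^ n \<le> x"
  proof (intro always_eventually allI)
    fix n
    have "B ^ n > 0" using assms by simp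
    moreover have "of_int \<lfloor>B ^ n * x\<rfloor> \<le> B ^ n * x" by linarith
    ultimately show "of_int \<lfloor>B ^ n * x\<rfloor> / B ^ n \<le> x"
      by (simp add: field_simps)
  qed
  have "(\<lambda>n. x - (1 / B) ^ n) \<longlonglongrightarrow> x - 0"
    using assms by (intro tendsto_intros LIMSEQ_realpow_zero) auto
  then show "(\<lambda>n. x - (1 / B) ^ n) \<longlonglongrightarrow> x" by simp
qed simp

lemma infinite_frac_digit_less:
  assumes "b \<ge> 2"
  shows "infinite {n. n \<ge> 1 \<and> frac_digit b x n < b - 1}"
proof
  assume "finite {n. n \<ge> 1 \<and> frac_digit b x n < b - 1}"
  then obtain K where K: "\<And>n. n \<ge> 1 \<Longrightarrow> frac_digit b x n < b - 1 \<Longrightarrow> n \<le> K"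
    by (auto simp: finite_nat_set_iff_bounded_le)
  define d where "d n = 1 - frac (of_int b ^ n * x)" for n
  have d: "0 < d n" "d n \<le> 1" for n
    by (simp_all add: d_def frac_lt_1)
  \<comment> \<open>Beyond \<open>K\<close> every digit is \<open>b - 1\<close>, and
    \<open>b - 1 = b * r - r'\<close> rearranges to \<open>1 - r' = b * (1 - r)\<close>.\<close>
  have step: "d (Suc n) = of_int b * d n" if "n \<ge> K" for n
  proof -
    have "frac_digit b x (Suc n) = b - 1"
      using K[of "Suc n"] that frac_digit_bounds(2)[OF assms, of "Suc n" x] by force
    with frac_digit_Suc_eq_frac[of b x n] show ?thesis
      by (simp add: d_def algebra_simps)
  qed
  have growth: "d (K + m) = of_int b ^ m * d K" for m
    by (induction m) (simp_all add: step)
  have "(1::real) < of_int b"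
    using assms by simp
  \<comment> \<open>Strict positivity of \<open>d K\<close> is essential here: a zero gap would
    never grow past 1.\<close>
  from real_arch_pow[OF this] obtain m where "1 / d K < of_int b ^ m"
    by blast
  then have "1 < d (K + m)"
    using d(1)[of K] by (simp add: growth field_simps)
  with d(2)[of "K + m"] show False by simp
qed

theorem theorem1p1:
  fixes b :: int
  assumes "b \<ge> 2"
  shows "\<forall>\<xi>::real. \<xi> > 0 \<longrightarrow>
    (\<exists>(s::nat) (A :: nat \<Rightarrow> int) (a :: nat \<Rightarrow> int).
       (\<lambda>n. positional b (s + 1) A n a) \<longlonglongrightarrow> \<xi> \<and>
       (\<forall>i\<in>{1..s+1}. 0 \<le> A i \<and> A i < b) \<and>
       (\<forall>n\<ge>1. 0 \<le> a n \<and> a n < b) \<and>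
       \<not> ((\<forall>i\<in>{1..s+1}. A i = 0) \<and> (\<forall>n\<ge>1. a n = 0)) \<and>
       infinite {n. n \<ge> 1 \<and> a n < b - 1} \<and>
       (\<xi> \<ge> 1 \<longrightarrow> A 1 > 0))"
proof (intro allI impI)
  fix \<xi> :: real
  assume "\<xi> > 0"
  then have "\<lfloor>\<xi>\<rfloor> \<ge> 0" by simp
  from integer_digit_expansion[OF assms this] obtain s A where
    sum_A: "(\<Sum>i=1..s+1. A i * b ^ (s + 1 - i)) = \<lfloor>\<xi>\<rfloor>" and
    digits: "\<forall>i\<in>{1..s+1}. 0 \<le> A i \<and> A i < b" and lead: "\<lfloor>\<xi>\<rfloor> \<ge> 1 \<longrightarrow> A 1 > 0"
    by blast
  define a where "a = frac_digit b \<xi>"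
  have "(\<Sum>i=1..s+1. of_int (A i) * of_int b ^ (s + 1 - i)) = real_of_int \<lfloor>\<xi>\<rfloor>"
    using arg_cong[OF sum_A, of real_of_int] by simp
  \<comment> \<open>The integer digits contribute exactly the \<open>\<lfloor>\<xi>\<rfloor>\<close>
    that the telescoped sum subtracts.\<close>
  then have "positional b (s + 1) A n a = of_int \<lfloor>of_int b ^ n * \<xi>\<rfloor> / of_int b ^ n" for n
    using assms sum_frac_digit[of b \<xi> n] unfolding positional_def a_def by simp
  then have lim: "(\<lambda>n. positional b (s + 1) A n a) \<longlonglongrightarrow> \<xi>"
    using floor_power_mult_div_tendsto[of "of_int b" \<xi>] assms by simp
  have nonzero: "\<not> ((\<forall>i\<in>{1..s+1}. A i = 0) \<and> (\<forall>n\<ge>1. a n = 0))"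
  proof
    assume "(\<forall>i\<in>{1..s+1}. A i = 0) \<and> (\<forall>n\<ge>1. a n = 0)"
    \<comment> \<open>With all digits zero the truncations are constantly 0, so uniqueness of limits
      gives \<open>\<xi> = 0\<close>.\<close>
    then have "positional b (s + 1) A n a = 0" for n
      by (auto simp: positional_def intro!: sum.neutral)
    with lim have "\<xi> = 0"
      by (simp add: LIMSEQ_const_iff)
    with \<open>\<xi> > 0\<close> show False by simp
  qed
  show "\<exists>(s::nat) (A :: nat \<Rightarrow> int) (a :: nat \<Rightarrow> int).
       (\<lambda>n. positional b (s + 1) A n a) \<longlonglongrightarrow> \<xi> \<and>
       (\<forall>i\<in>{1..s+1}. 0 \<le> A i \<and> A i < b) \<and>
       (\<forall>n\<ge>1. 0 \<le> a n \<and> a n < b) \<and>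
       \<not> ((\<forall>i\<in>{1..s+1}. A i = 0) \<and> (\<forall>n\<ge>1. a n = 0)) \<and>
       infinite {n. n \<ge> 1 \<and> a n < b - 1} \<and>
       (\<xi> \<ge> 1 \<longrightarrow> A 1 > 0)"
  proof (intro exI conjI)
    show "\<forall>n\<ge>1. 0 \<le> a n \<and> a n < b"
      using frac_digit_bounds[OF assms] by (simp add: a_def)
    show "infinite {n. n \<ge> 1 \<and> a n < b - 1}"
      unfolding a_def by (rule infinite_frac_digit_less[OF assms])
    show "\<xi> \<ge> 1 \<longrightarrow> A 1 > 0"
      using lead by simp
  qed (fact lim digits nonzero)+
qed

end
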